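(* Let $X$ be a set, let $T: X \to X$ be an invertible map with $T^n = \mathrm{Id}_X$ for a fixed integer $n \geq 1$, and let $g_1,\dots,g_k: X \to \mathbb{C}$ be functions. Let $V$ be the complex linear span of the functions $g_i \circ T^j$ ($1 \leq i \leq k$, $0 \leq j < n$), and let $U: V \to V$ be the linear operator $Uf = f \circ T$. Let $V_1 \subseteq V$ be the span of the eigenvectors of $U$ with eigenvalue $1$, and let $V_1^\perp \subseteq V$ be the span of the eigenvectors of $U$ with eigenvalue different from $1$. Then $V_1$ is exactly the set of invariant functions in $V$, and $V_1^\perp$ is exactly the set of 0-mesic functions in $V$.
   Context: The operator $U$ is well defined on $V$ and satisfies $U^n = I$, so $U$ is diagonalizable over $\mathbb{C}$ with eigenvalues that are $n$th roots of unity. A function $f \in V$ is called invariant if $Uf = f$, i.e. $f(Tx) = f(x)$ for all $x \in X$. A function $f \in V$ is called 0-mesic (a 0-mesy) if $\frac{1}{n}\sum_{j=0}^{n-1} U^j f = 0$, i.e. $\frac{1}{n}\sum_{j=0}^{n-1} f(T^j x) = 0$ for all $x \in X$. The notation $V_1^\perp$ does not refer to any inner product. *)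

theory Defs
  imports Complex_Main "HOL-Library.Function_Algebras"
begin

text \<open>
  A function on a set \<open>X\<close> is represented by a total function that vanishes outside \<open>X\<close>,
  so that equality of functions on \<open>X\<close> is equality in HOL.  Addition and zero are the
  pointwise ones of \<open>Function_Algebras\<close>.
\<close>

definition scaleF :: "complex \<Rightarrow> ('a \<Rightarrow> complex) \<Rightarrow> 'a \<Rightarrow> complex" where
  "scaleF c f = (\<lambda>x. c * f x)"

global_interpretation cfun: vector_space "scaleF :: complex \<Rightarrow> ('a \<Rightarrow> complex) \<Rightarrow> _"
  by unfold_locales (auto simp: scaleF_def fun_eq_iff algebra_simps)

definition pullback :: "'a set \<Rightarrow> ('a \<Rightarrow> 'a) \<Rightarrow> ('a \<Rightarrow> complex) \<Rightarrow> 'a \<Rightarrow> complex" where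
  "pullback X S f = (\<lambda>x. if x \<in> X then f (S x) else 0)"

text \<open>
  Only the values of \<open>g i\<close> on \<open>X\<close> matter here, provided that \<open>T\<close> maps \<open>X\<close> to itself; for
  \<open>j = 0\<close> the generator is \<open>g i\<close>, extended by zero outside \<open>X\<close>.
\<close>

definition orbit_space ::
  "'a set \<Rightarrow> ('a \<Rightarrow> 'a) \<Rightarrow> nat \<Rightarrow> nat \<Rightarrow> (nat \<Rightarrow> 'a \<Rightarrow> complex) \<Rightarrow> ('a \<Rightarrow> complex) set" where
  "orbit_space X T n k g = cfun.span {pullback X (T ^^ j) (g i) | i j. i \<in> {1..k} \<and> j < n}"

definition eigenvector_in ::
  "('a \<Rightarrow> complex) set \<Rightarrow> (('a \<Rightarrow> complex) \<Rightarrow> 'a \<Rightarrow> complex) \<Rightarrow> complex \<Rightarrow> ('a \<Rightarrow> complex) \<Rightarrow> bool" where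
  "eigenvector_in V U \<mu> f \<longleftrightarrow> f \<in> V \<and> f \<noteq> 0 \<and> U f = scaleF \<mu> f"

definition V_one ::
  "('a \<Rightarrow> complex) set \<Rightarrow> (('a \<Rightarrow> complex) \<Rightarrow> 'a \<Rightarrow> complex) \<Rightarrow> ('a \<Rightarrow> complex) set" where
  "V_one V U = cfun.span {f. eigenvector_in V U 1 f}"

definition V_one_perp ::
  "('a \<Rightarrow> complex) set \<Rightarrow> (('a \<Rightarrow> complex) \<Rightarrow> 'a \<Rightarrow> complex) \<Rightarrow> ('a \<Rightarrow> complex) set" where
  "V_one_perp V U = cfun.span {f. \<exists>\<mu>. \<mu> \<noteq> 1 \<and> eigenvector_in V U \<mu> f}"

definition invariant :: "(('a \<Rightarrow> complex) \<Rightarrow> 'a \<Rightarrow> complex) \<Rightarrow> ('a \<Rightarrow> complex) \<Rightarrow> bool" where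
  "invariant U f \<longleftrightarrow> U f = f"

definition zero_mesic :: "nat \<Rightarrow> (('a \<Rightarrow> complex) \<Rightarrow> 'a \<Rightarrow> complex) \<Rightarrow> ('a \<Rightarrow> complex) \<Rightarrow> bool" where
  "zero_mesic n U f \<longleftrightarrow> scaleF (1 / of_nat n) (\<Sum>j<n. (U ^^ j) f) = 0"

lemma sum_fun_apply: "(\<Sum>j\<in>A. F j) x = (\<Sum>j\<in>A. F j x :: complex)"
  by (induction A rule: infinite_finite_induct) auto

lemma pullback_scaleF: "pullback X S (scaleF c f) = scaleF c (pullback X S f)"
  by (auto simp: pullback_def scaleF_def)

lemma pullback_add: "pullback X S (f + h) = pullback X S f + pullback X S h"
  by (auto simp: pullback_def fun_eq_iff)

lemma pullback_zero: "pullback X S 0 = 0"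
  by (auto simp: pullback_def fun_eq_iff)

lemma funpow_in_set:
  assumes "T ` X \<subseteq> X" "x \<in> X"
  shows "(T ^^ j) x \<in> X"
  using assms by (induction j) auto

lemma funpow_pullback:
  assumes "T ` X \<subseteq> X" "x \<in> X"
  shows "(pullback X T ^^ j) f x = f ((T ^^ j) x)"
  using assms(2)
proof (induction j arbitrary: x)
  case (Suc j)
  then have "T x \<in> X" using assms(1) by auto
  with Suc show ?case by (simp add: pullback_def funpow_swap1)
qed simp

lemma orbit_space_vanishes:
  assumes "f \<in> orbit_space X T n k g" "x \<notin> X"
  shows "f x = 0"
  using assms(1) unfolding orbit_space_def
  by (induction rule: cfun.span_induct_alt) (use assms(2) in \<open>auto simp: pullback_def scaleF_def\<close>)

lemma invariant_iff:
  assumes "f \<in> orbit_space X T n k g"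
  shows "invariant (pullback X T) f \<longleftrightarrow> (\<forall>x\<in>X. f (T x) = f x)"
  using orbit_space_vanishes[OF assms] by (auto simp: invariant_def pullback_def fun_eq_iff)

lemma zero_mesic_iff:
  assumes "T ` X \<subseteq> X" "f \<in> orbit_space X T n k g"
  shows "zero_mesic n (pullback X T) f \<longleftrightarrow> (\<forall>x\<in>X. 1 / of_nat n * (\<Sum>j<n. f ((T ^^ j) x)) = 0)"
proof -
  have off: "(pullback X T ^^ j) f x = 0" if "x \<notin> X" for j x
    using that orbit_space_vanishes[OF assms(2)] by (cases j) (auto simp: pullback_def)
  have "(\<Sum>j<n. (pullback X T ^^ j) f x) = (if x \<in> X then \<Sum>j<n. f ((T ^^ j) x) else 0)" for x
    by (simp add: off funpow_pullback[OF assms(1)])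
  then show ?thesis
    by (auto simp: zero_mesic_def scaleF_def sum_fun_apply fun_eq_iff)
qed

lemma pullback_orbit_space:
  assumes "T ` X \<subseteq> X" "n \<ge> 1" "\<forall>x\<in>X. (T ^^ n) x = x" "f \<in> orbit_space X T n k g"
  shows "pullback X T f \<in> orbit_space X T n k g"
  using assms(4) unfolding orbit_space_def
proof (induction rule: cfun.span_induct_alt)
  case base
  show ?case by (simp only: pullback_zero cfun.span_zero)
next
  case (step c h f)
  then obtain i j where ij: "i \<in> {1..k}" "j < n" "h = pullback X (T ^^ j) (g i)" by auto
  have eq: "pullback X T h = pullback X (T ^^ Suc j) (g i)"
    using assms(1) by (auto simp: ij(3) pullback_def fun_eq_iff funpow_swap1)
  have "pullback X T h \<in> {pullback X (T ^^ j) (g i) | i j. i \<in> {1..k} \<and> j < n}"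
  proof (cases "Suc j < n")
    case True
    then show ?thesis using ij eq by blast
  next
    case False
    then have "Suc j = n" using ij(2) by simp
    then have "pullback X T h = pullback X (T ^^ 0) (g i)"
      unfolding eq using assms(3) by (auto simp: pullback_def fun_eq_iff simp del: funpow.simps(2))
    moreover have "0 < n" using assms(2) by simp
    ultimately show ?thesis using ij(1) by blast
  qed
  then show ?case
    using step(2) by (simp only: pullback_add pullback_scaleF cfun.span_add cfun.span_scale cfun.span_base)
qed

end

theory Submission
  imports Defs
begin

text \<open>
  For \<open>z ^ n = 1\<close>, the operator \<open>f \<mapsto> (\<Sum>j<n. z ^ j U ^ j f)\<close> maps into the eigenspace of
  \<open>U\<close> with eigenvalue \<open>1 / z\<close>, and averaging these operators over the \<open>n\<close>th roots of unity gives
  the identity. For \<open>z = 1\<close> the operator is \<open>n\<close> times the time average, so a 0-mesic function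
  has no component with eigenvalue \<open>1\<close>. Conversely, an eigenvalue \<open>\<mu> \<noteq> 1\<close> satisfies
  \<open>\<mu> ^ n = 1\<close>, so that the time average multiplies its eigenvectors by \<open>(\<Sum>j<n. \<mu> ^ j) / n = 0\<close>.
\<close>

lemma sum_powers_root_of_unity:
  fixes z :: "'a::field"
  assumes "z ^ n = 1" "z \<noteq> 1"
  shows "(\<Sum>j<n. z ^ j) = 0"
  using geometric_sum[OF assms(2), of n] assms(1) by simp

lemma power_root_of_unity:
  fixes z :: "'a::monoid_mult"
  assumes "z ^ n = 1"
  shows "(z ^ m) ^ n = 1"
proof -
  have "(z ^ m) ^ n = (z ^ n) ^ m"
    by (simp only: mult.commute flip: power_mult)
  then show ?thesis using assms by simp
qed

text \<open>Otherwise the angle \<open>j * (2 * pi / n)\<close> would have cosine \<open>1\<close>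
  and be a whole multiple of \<open>2 * pi\<close>, so \<open>n\<close> would divide
  \<open>j\<close>, impossible for \<open>0 < j < n\<close>.\<close>

lemma cis_root_power_neq_1:
  fixes j n :: nat
  assumes "0 < j" "j < n"
  shows "cis (2 * pi / n) ^ j \<noteq> 1"
proof
  assume "cis (2 * pi / n) ^ j = 1"
  then have "cos (j * (2 * pi / n)) = 1"
    by (simp only: DeMoivre complex_eq_iff cis.sel one_complex.sel)
  then obtain i :: int where "j * (2 * pi / n) = real_of_int i * 2 * pi"
    using cos_one_2pi_int by blast
  then have "real j = i * real n"
    using assms by (simp add: field_simps)
  then have "real_of_int (int j) = real_of_int (i * int n)"
    by simp
  then have "int j = i * int n"
    by (simp only: of_int_eq_iff)
  then have "int n dvd int j"
    by (rule dvdI[OF trans[OF _ mult.commute]])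
  then have "n dvd j"
    by simp
  with assms show False
    by (auto dest: dvd_imp_le)
qed

lemma cis_root_power_n: "n \<ge> 1 \<Longrightarrow> cis (2 * pi / n) ^ n = 1"
  by (simp add: DeMoivre)

lemma funpow_eigenvector:
  assumes "Vector_Spaces.linear scaleF scaleF U" "U f = scaleF \<mu> f"
  shows "(U ^^ j) f = scaleF (\<mu> ^ j) f"
proof -
  interpret Vector_Spaces.linear scaleF scaleF U by fact
  show ?thesis
    by (induction j) (simp_all add: scale assms(2) mult.commute)
qed

lemma linear_funpow:
  fixes U :: "('a \<Rightarrow> complex) \<Rightarrow> 'a \<Rightarrow> complex"
  assumes "Vector_Spaces.linear scaleF scaleF U"
  shows "Vector_Spaces.linear scaleF scaleF (U ^^ j)"
proof (induction j)
  case 0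
  show ?case using cfun.linear_id by (simp add: id_def)
next
  case (Suc j)
  show ?case
    using Vector_Spaces.linear_compose[OF Suc assms] by (simp add: comp_def)
qed

text \<open>Multiplying \<open>U h\<close> by \<open>z\<close> shifts the summation index by one,
  and the sum is cyclic because its term of index \<open>n\<close> equals that of index
  \<open>0\<close>.\<close>

lemma eigenvector_power_sum:
  assumes "Vector_Spaces.linear scaleF scaleF U" "(U ^^ n) f = f" "z ^ n = 1" "n \<ge> 1"
  defines "h \<equiv> (\<Sum>j<n. scaleF (z ^ j) ((U ^^ j) f))"
  shows "U h = scaleF (1 / z) h"
proof -
  interpret Vector_Spaces.linear scaleF scaleF U by fact
  \<comment> \<open>Since \<open>0 ^ 0 = 1\<close>, this relies on \<open>n \<ge> 1\<close>.\<close>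
  have z: "z \<noteq> 0" using assms(3,4) by (auto simp: power_0_left)
  define F where "F j = scaleF (z ^ j) ((U ^^ j) f)" for j
  have "scaleF z (U h) = (\<Sum>j<n. F (Suc j))"
    by (simp add: h_def F_def sum scale cfun.scale_sum_right)
  also have "\<dots> = (\<Sum>j<n. F j) + F n - F 0"
    using sum.lessThan_Suc_shift[of F n] by (simp add: algebra_simps)
  also have "F n = F 0"
    by (simp add: F_def assms(2,3))
  finally have "scaleF z (U h) = h"
    by (simp add: h_def F_def)
  then have "scaleF (1 / z) (scaleF z (U h)) = scaleF (1 / z) h" by simp
  then show ?thesis using z by simp
qed

text \<open>Inverse discrete Fourier transform: after swapping the sums, the coefficient of
  \<open>(U ^^ j) f\<close> is the sum of the \<open>j\<close>th powers of all \<open>n\<close>th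
  roots of unity, which is \<open>n\<close> for \<open>j = 0\<close> and \<open>0\<close> for
  \<open>0 < j < n\<close>.\<close>

lemma average_power_sums:
  assumes "n \<ge> 1"
  shows "f = scaleF (1 / of_nat n)
    (\<Sum>m<n. \<Sum>j<n. scaleF ((cis (2 * pi / n) ^ m) ^ j) ((U ^^ j) f))"
proof -
  let ?w = "cis (2 * pi / n)"
  have root: "(\<Sum>m<n. (?w ^ m) ^ j) = (if j = 0 then of_nat n else 0)" if "j < n" for j
  proof (cases "j = 0")
    case False
    \<comment> \<open>As a sum over \<open>m\<close>, this is geometric with ratio
      \<open>?w ^ j\<close>, an \<open>n\<close>th root of unity other than
      \<open>1\<close>.\<close>
    have "(?w ^ j) ^ n = 1"
      using assms by (intro power_root_of_unity cis_root_power_n)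
    then have "(\<Sum>m<n. (?w ^ j) ^ m) = 0"
      using False that cis_root_power_neq_1 by (intro sum_powers_root_of_unity) auto
    then show ?thesis
      using False by (simp only: mult.commute if_False flip: power_mult)
  qed simp
  have "(\<Sum>m<n. \<Sum>j<n. scaleF ((?w ^ m) ^ j) ((U ^^ j) f))
      = (\<Sum>j<n. scaleF (\<Sum>m<n. (?w ^ m) ^ j) ((U ^^ j) f))"
    by (subst sum.swap) (simp only: cfun.scale_sum_left)
  also have "\<dots> = (\<Sum>j<n. if j = 0 then scaleF (of_nat n) f else 0)"
    by (rule sum.cong) (simp_all add: root del: power_Suc)
  also have "\<dots> = scaleF (of_nat n) f"
    using assms by simp
  finally show ?thesis using assms by simp
qed

text \<open>The invariant functions in \<open>V\<close> already form a subspace, so the span adds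
  only the zero function to the eigenvectors.\<close>

lemma V_one_eq:
  assumes "Vector_Spaces.linear scaleF scaleF U" "cfun.subspace V"
  shows "V_one V U = {f \<in> V. invariant U f}"
proof -
  interpret Vector_Spaces.linear scaleF scaleF U by fact
  have "cfun.subspace {f \<in> V. invariant U f}"
    using assms(2) by (auto simp: invariant_def cfun.subspace_def add scale)
  then have "V_one V U \<subseteq> {f \<in> V. invariant U f}"
    unfolding V_one_def
    by (intro cfun.span_minimal) (auto simp: eigenvector_in_def invariant_def)
  moreover have "f \<in> V_one V U" if "f \<in> V" "invariant U f" for f
  proof (cases "f = 0")
    case True
    then show ?thesis by (simp only: V_one_def cfun.span_zero)
  next
    case False
    with that show ?thesis
      unfolding V_one_def
      by (intro cfun.span_base) (auto simp: eigenvector_in_def invariant_def)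
  qed
  ultimately show ?thesis by blast
qed

text \<open>Reduces the inclusion of \<open>V_one_perp\<close> in the 0-mesic functions to a check
  on single eigenvectors. Time averaging is linear because every power of \<open>U\<close>
  is.\<close>

lemma subspace_zero_mesic:
  assumes "Vector_Spaces.linear scaleF scaleF U" "cfun.subspace V"
  shows "cfun.subspace {f \<in> V. zero_mesic n U f}"
proof -
  have lin: "module_hom scaleF scaleF (U ^^ j)" for j
    using linear_funpow[OF assms(1)] by (simp add: module_hom_iff_linear)
  have "zero_mesic n U 0"
    by (simp add: zero_mesic_def module_hom.zero[OF lin])
  moreover have "zero_mesic n U (f + h)" if "zero_mesic n U f" "zero_mesic n U h" for f h
    using that
    by (simp add: zero_mesic_def module_hom.add[OF lin] sum.distrib cfun.scale_right_distrib
        del: cfun.scale_eq_0_iff)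
  moreover have "zero_mesic n U (scaleF c f)" if "zero_mesic n U f" for c f
    using that
    by (auto simp add: zero_mesic_def module_hom.scale[OF lin] simp flip: cfun.scale_sum_right)
  ultimately show ?thesis
    using assms(2) by (simp add: cfun.subspace_def)
qed

lemma V_one_perp_eq:
  assumes lin: "Vector_Spaces.linear scaleF scaleF U" and V: "cfun.subspace V"
    and inv: "\<And>f. f \<in> V \<Longrightarrow> U f \<in> V" and per: "\<And>f. f \<in> V \<Longrightarrow> (U ^^ n) f = f" and n: "n \<ge> 1"
  shows "V_one_perp V U = {f \<in> V. zero_mesic n U f}"
proof
  have "zero_mesic n U f" if "eigenvector_in V U \<mu> f" "\<mu> \<noteq> 1" for \<mu> f
  proof -
    from that have f: "f \<in> V" "f \<noteq> 0" "U f = scaleF \<mu> f"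
      by (auto simp: eigenvector_in_def)
    have pow: "(U ^^ j) f = scaleF (\<mu> ^ j) f" for j
      by (rule funpow_eigenvector[OF lin f(3)])
    have "scaleF (\<mu> ^ n) f = scaleF 1 f"
      using pow[of n] per[OF f(1)] by simp
    then have "\<mu> ^ n = 1"
      using f(2) by (simp only: cfun.scale_cancel_right) simp
    then have "(\<Sum>j<n. \<mu> ^ j) = 0"
      using that(2) by (rule sum_powers_root_of_unity)
    then show ?thesis
      by (simp add: zero_mesic_def pow flip: cfun.scale_sum_left)
  qed
  then show "V_one_perp V U \<subseteq> {f \<in> V. zero_mesic n U f}"
    unfolding V_one_perp_def
    by (intro cfun.span_minimal subspace_zero_mesic lin V) (auto simp: eigenvector_in_def)
next
  show "{f \<in> V. zero_mesic n U f} \<subseteq> V_one_perp V U"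
  proof safe
    fix f assume f: "f \<in> V" "zero_mesic n U f"
    have UV: "(U ^^ j) f \<in> V" for j
      by (induction j) (simp_all add: f inv)
    have "(\<Sum>j<n. scaleF (z ^ j) ((U ^^ j) f)) \<in> V_one_perp V U" (is "?h \<in> _")
      if z: "z ^ n = 1" for z
    proof (cases "?h = 0")
      case True
      then show ?thesis by (simp only: V_one_perp_def cfun.span_zero)
    next
      case False
      \<comment> \<open>For \<open>z = 1\<close> the sum is \<open>n\<close> times the time average
        of \<open>f\<close>, hence zero. So a nonzero \<open>?h\<close> has eigenvalue
        \<open>1 / z\<close> different from \<open>1\<close>.\<close>
      have "z \<noteq> 1"
        using False f(2) n by (auto simp: zero_mesic_def)
      moreover have "?h \<in> V"
        by (intro cfun.subspace_sum cfun.subspace_scale V UV)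
      ultimately show ?thesis
        unfolding V_one_perp_def eigenvector_in_def
        using False eigenvector_power_sum[OF lin per[OF f(1)] z n]
        by (intro cfun.span_base CollectI exI[of _ "1 / z"]) auto
    qed
    moreover have "(cis (2 * pi / n) ^ m) ^ n = 1" for m
      using n by (intro power_root_of_unity cis_root_power_n)
    ultimately have "(\<Sum>j<n. scaleF ((cis (2 * pi / n) ^ m) ^ j) ((U ^^ j) f)) \<in> V_one_perp V U" for m
      by blast
    then have "scaleF (1 / of_nat n)
        (\<Sum>m<n. \<Sum>j<n. scaleF ((cis (2 * pi / n) ^ m) ^ j) ((U ^^ j) f)) \<in> V_one_perp V U"
      unfolding V_one_perp_def by (rule cfun.span_scale[OF cfun.span_sum])
    then show "f \<in> V_one_perp V U"
      by (simp only: average_power_sums[OF n, symmetric])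
  qed
qed

lemma linear_pullback: "Vector_Spaces.linear scaleF scaleF (pullback X T)"
  by unfold_locales (simp_all only: pullback_add pullback_scaleF)

text \<open>On \<open>X\<close> this is the periodicity of \<open>T\<close>. Off \<open>X\<close> it
  holds because functions in the orbit space vanish there, as do all values of
  \<open>pullback\<close>; for other functions it can fail.\<close>

lemma funpow_pullback_orbit_space:
  assumes "T ` X \<subseteq> X" "n \<ge> 1" "\<forall>x\<in>X. (T ^^ n) x = x" "f \<in> orbit_space X T n k g"
  shows "(pullback X T ^^ n) f = f"
proof
  fix x
  show "(pullback X T ^^ n) f x = f x"
  proof (cases "x \<in> X")
    case True
    then show ?thesis using assms(1,3) by (simp add: funpow_pullback)
  next
    case False
    then show ?thesis
      using assms(2) orbit_space_vanishes[OF assms(4) False]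
      by (cases n) (auto simp: pullback_def)
  qed
qed

theorem proposition2p1:
  fixes X :: "'a set" and T :: "'a \<Rightarrow> 'a" and n k :: nat
    and g :: "nat \<Rightarrow> 'a \<Rightarrow> complex"
    and V :: "('a \<Rightarrow> complex) set" and U :: "('a \<Rightarrow> complex) \<Rightarrow> 'a \<Rightarrow> complex"
  assumes "bij_betw T X X"
    and "n \<ge> 1"
    and "\<forall>x\<in>X. (T ^^ n) x = x"
    and "V = orbit_space X T n k g"
    and "U = pullback X T"
  shows "V_one V U = {f \<in> V. invariant U f} \<and> V_one_perp V U = {f \<in> V. zero_mesic n U f}"
proof -
  have T: "T ` X \<subseteq> X"
    using assms(1) by (simp add: bij_betw_def)
  have lin: "Vector_Spaces.linear scaleF scaleF U"
    unfolding assms(5) by (rule linear_pullback)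
  have V: "cfun.subspace V"
    unfolding assms(4) orbit_space_def by (rule cfun.subspace_span)
  \<comment> \<open>The eigenspace lemmas see \<open>T\<close> only through the linearity of
    \<open>U\<close>, the stability of the subspace \<open>V\<close> under \<open>U\<close>, and
    \<open>U ^^ n\<close> being the identity on \<open>V\<close>.\<close>
  have "U f \<in> V" "(U ^^ n) f = f" if "f \<in> V" for f
    using that pullback_orbit_space[OF T assms(2,3)] funpow_pullback_orbit_space[OF T assms(2,3)]
    unfolding assms(4,5) by blast+
  then show ?thesis
    using V_one_eq[OF lin V] V_one_perp_eq[OF lin V _ _ assms(2)] by blast
qed

end
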